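(* Let $n \geq 1$ and let $m$ be a positive integer. Let $\alpha_{1},\dots,\alpha_{n}>0$ and $\beta_{1},\dots,\beta_{n}>0$ be real numbers with $\beta_{1}=\min_{1\leq i\leq n}\beta_{i}$, and put $A=\sum_{i=1}^{n}\alpha_{i}$. Define $\gamma_{l}=\sum_{i=1}^{n} \alpha_{i}(1-\beta_{1}/\beta_{i})^{l}/l$ for $l=1,2,\dots$, and define $\delta_{0}=1$ and recursively \[ \delta_{j+1}=\frac{1}{j+1}\sum_{l=1}^{j+1} l\,\gamma_{l}\,\delta_{j+1-l},\qquad j=0,1,2,\dots. \] Then \[ \prod_{i=1}^{n}\Big(\frac{\beta_{1}}{\beta_{i}}\Big)^{\alpha_{i}} \beta_{1}^{m}\sum_{j=0}^{\infty}\delta_{j}\frac{(A+j+m-1)!}{(A+j-1)!} =\sum_{i_{1}+\cdots+i_{n}=m}\binom{m}{i_{1},\dots,i_{n}}\frac{(\alpha_{1}+i_{1}-1)!}{(\alpha_{1}-1)!}\beta_{1}^{i_{1}}\cdots\frac{(\alpha_{n}+i_{n}-1)!}{(\alpha_{n}-1)!}\beta_{n}^{i_{n}}, \] where the sum on the right runs over all $n$-tuples of nonnegative integers with $i_1+\cdots+i_n=m$.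
   Context: For a real number $x>-1$, $x!$ denotes $\Gamma(x+1)$; thus $\frac{(y+k-1)!}{(y-1)!}=\frac{\Gamma(y+k)}{\Gamma(y)}$ for real $y>0$ and integer $k\ge 0$. $\binom{m}{i_1,\dots,i_n}=\frac{m!}{i_1!\cdots i_n!}$ is the multinomial coefficient. *)

theory Defs
  imports "HOL-Analysis.Analysis"
begin

text \<open>The factorial of a real number, intended for arguments greater than -1.\<close>

definition real_fact :: "real \<Rightarrow> real" where
  "real_fact x = Gamma (x + 1)"

text \<open>Families indexed by \<open>1, \<dots>, n\<close> are functions on \<open>nat\<close> of which only the values on
  \<open>{1..n}\<close> matter.\<close>

definition multinomial_coeff :: "nat \<Rightarrow> nat \<Rightarrow> (nat \<Rightarrow> nat) \<Rightarrow> real" where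
  "multinomial_coeff n m i = fact m / (\<Prod>k=1..n. fact (i k))"

text \<open>The extensional function space makes each tuple correspond to exactly one function.\<close>

definition weak_compositions :: "nat \<Rightarrow> nat \<Rightarrow> (nat \<Rightarrow> nat) set" where
  "weak_compositions n m = {i \<in> {1..n} \<rightarrow>\<^sub>E UNIV. (\<Sum>k=1..n. i k) = m}"

lemma finite_weak_compositions: "finite (weak_compositions n m)"
proof (rule finite_subset)
  show "weak_compositions n m \<subseteq> {1..n} \<rightarrow>\<^sub>E {..m}"
  proof
    fix i assume i: "i \<in> weak_compositions n m"
    have "i k \<le> m" if "k \<in> {1..n}" for k
      using i member_le_sum[OF that, of i] by (simp add: weak_compositions_def)
    with i show "i \<in> {1..n} \<rightarrow>\<^sub>E {..m}"
      by (simp add: weak_compositions_def PiE_iff)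
  qed
  show "finite ({1..n} \<rightarrow>\<^sub>E {..m})"
    by (intro finite_PiE) auto
qed

text \<open>Only the values for \<open>l \<ge> 1\<close> are used.\<close>

definition gamma_coeff :: "nat \<Rightarrow> (nat \<Rightarrow> real) \<Rightarrow> (nat \<Rightarrow> real) \<Rightarrow> nat \<Rightarrow> real" where
  "gamma_coeff n \<alpha> \<beta> l = (\<Sum>i=1..n. \<alpha> i * (1 - \<beta> 1 / \<beta> i) ^ l / real l)"

fun delta_coeff :: "nat \<Rightarrow> (nat \<Rightarrow> real) \<Rightarrow> (nat \<Rightarrow> real) \<Rightarrow> nat \<Rightarrow> real" where
  "delta_coeff n \<alpha> \<beta> 0 = 1"
| "delta_coeff n \<alpha> \<beta> (Suc j) =
     1 / real (j + 1) *
       (\<Sum>l=1..j+1. real l * gamma_coeff n \<alpha> \<beta> l * delta_coeff n \<alpha> \<beta> (j + 1 - l))"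

end

theory Submission
  imports Defs
begin

unbundle no vec_syntax and fps_syntax

text \<open>Put \<open>c\<^sub>i = 1 - \<beta>\<^sub>1 / \<beta>\<^sub>i\<close>, so \<open>0 \<le> c\<^sub>i < 1\<close>. The recursion for \<open>\<delta>\<close> is the logarithmic derivative
  of \<open>D(z) = \<Prod>\<^sub>i (1 - c\<^sub>i z) powr (-\<alpha>\<^sub>i)\<close>, so \<open>\<delta>\<^sub>j\<close> is the \<open>j\<close>-th coefficient of \<open>D\<close>.
  With rising factorials \<open>(x)\<^sub>k\<close>, a single factor satisfies
  \<open>\<Sum>\<^sub>j (\<alpha>)\<^sub>j c\<^sup>j / j! \<cdot> (\<alpha> + j)\<^sub>k = (\<alpha>)\<^sub>k (1 - c) powr (-\<alpha> - k)\<close>, by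
  \<open>(\<alpha>)\<^sub>j (\<alpha> + j)\<^sub>k = (\<alpha>)\<^sub>k (\<alpha> + k)\<^sub>j\<close> and the binomial series. The Vandermonde identity for
  \<open>(A + j)\<^sub>m\<close> splits the series for \<open>D\<close> into Cauchy products of these single-factor series, and
  expanding the resulting product over compositions of \<open>m\<close> gives the right-hand side.\<close>

section \<open>Moments of a single binomial series\<close>

lemma neg_binomial_sums:
  fixes a c :: real
  assumes "\<bar>c\<bar> < 1"
  shows "(\<lambda>j. pochhammer a j / fact j * c ^ j) sums (1 - c) powr (- a)"
proof -
  have "(- a gchoose k) * (- c) ^ k = pochhammer a k / fact k * c ^ k" for k
    by (simp add: gbinomial_pochhammer power_minus[of c])
  then show ?thesis
    using gen_binomial_real[of "- c" "- a"] assms by simp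
qed

lemma neg_binomial_moment_sums:
  fixes a c :: real
  assumes "\<bar>c\<bar> < 1"
  shows "(\<lambda>j. pochhammer a j / fact j * c ^ j * (pochhammer (a + real j) k / fact k)) sums
    (pochhammer a k / fact k * (1 - c) powr (- a - real k))"
proof -
  \<comment> \<open>Both products equal \<open>pochhammer a (j + k)\<close>.\<close>
  have "pochhammer a j * pochhammer (a + real j) k = pochhammer a k * pochhammer (a + real k) j" for j
    by (metis pochhammer_product' add.commute)
  then have eq: "pochhammer a k / fact k * (pochhammer (a + real k) j / fact j * c ^ j)
      = pochhammer a j / fact j * c ^ j * (pochhammer (a + real j) k / fact k)" for j
    by (simp add: field_simps)
  have "- (a + real k) = - a - real k"
    by simp
  then show ?thesis
    using sums_mult[OF neg_binomial_sums[OF assms, of "a + real k"], of "pochhammer a k / fact k"]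
    by (simp only: eq)
qed

section \<open>Vandermonde convolution and moments of products\<close>

text \<open>Dividing by factorials absorbs the binomial weights and leaves a plain convolution in
  \<open>k\<close>, so that moments of different orders multiply like coefficients of power
  series.\<close>

lemma pochhammer_Vandermonde:
  fixes a b :: "'a :: field_char_0"
  shows "pochhammer (a + b) m / fact m =
    (\<Sum>k\<le>m. pochhammer a k / fact k * (pochhammer b (m - k) / fact (m - k)))"
proof -
  have "(\<Sum>k\<le>m. pochhammer a k / fact k * (pochhammer b (m - k) / fact (m - k)))
      = (\<Sum>k\<le>m. of_nat (m choose k) * pochhammer a k * pochhammer b (m - k) / fact m)"
    by (intro sum.cong refl) (simp add: binomial_fact field_simps)
  then show ?thesis
    by (simp add: pochhammer_binomial_sum sum_divide_distrib)
qed

text \<open>\<open>U\<close> and \<open>V\<close> collect the moments of all orders of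
  \<open>F\<close> and \<open>G\<close>. Two convolutions meet here: the Cauchy product in the
  summation index and Vandermonde in the order. Nonnegativity makes convergence absolute, which the
  Cauchy product requires.\<close>

lemma pochhammer_moment_sums_mult:
  fixes F G U V :: "real fps"
  assumes F: "\<And>k. (\<lambda>j. F $ j * (pochhammer (a + real j) k / fact k)) sums (U $ k)"
    and G: "\<And>k. (\<lambda>j. G $ j * (pochhammer (b + real j) k / fact k)) sums (V $ k)"
    and nonneg: "\<And>j. F $ j \<ge> 0" "\<And>j. G $ j \<ge> 0" "a \<ge> 0" "b \<ge> 0"
  shows "(\<lambda>j. (F * G) $ j * (pochhammer (a + b + real j) m / fact m)) sums ((U * V) $ m)"
proof -
  define f where "f k j = F $ j * (pochhammer (a + real j) k / fact k)" for k j
  define g where "g k j = G $ j * (pochhammer (b + real j) k / fact k)" for k j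
  have nn: "pochhammer x k \<ge> 0" if "x \<ge> 0" for x :: real and k
    using that by (simp add: pochhammer_prod prod_nonneg)
  have "f k j \<ge> 0" "g k j \<ge> 0" for k j
    using nonneg by (auto simp: f_def g_def intro!: mult_nonneg_nonneg divide_nonneg_nonneg nn)
  then have "norm (f k j) = f k j" "norm (g k j) = g k j" for k j
    by simp_all
  moreover have "summable (f k)" "summable (g k)" for k
    unfolding f_def g_def using F[of k] G[of k] by (auto dest: sums_summable)
  ultimately have "summable (\<lambda>j. norm (f k j))" "summable (\<lambda>j. norm (g k j))" for k
    by simp_all
  then have "(\<lambda>j. \<Sum>i\<le>j. f k i * g l (j - i)) sums ((\<Sum>j. f k j) * (\<Sum>j. g l j))" for k l
    by (rule Cauchy_product_sums)
  moreover have "(\<Sum>j. f k j) = U $ k" "(\<Sum>j. g k j) = V $ k" for k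
    unfolding f_def g_def by (rule sums_unique[OF F, symmetric], rule sums_unique[OF G, symmetric])
  ultimately have "(\<lambda>j. \<Sum>k\<le>m. \<Sum>i\<le>j. f k i * g (m - k) (j - i)) sums (\<Sum>k\<le>m. U $ k * V $ (m - k))"
    by (intro sums_sum) auto
  moreover have "(\<Sum>k\<le>m. \<Sum>i\<le>j. f k i * g (m - k) (j - i))
      = (F * G) $ j * (pochhammer (a + b + real j) m / fact m)" for j
  proof -
    \<comment> \<open>The shifts \<open>i\<close> and \<open>j - i\<close> add up to
      \<open>j\<close>, so the Vandermonde sum over \<open>k\<close> is the same for every
      \<open>i\<close> and factors out of the coefficient of \<open>F * G\<close>.\<close>
    have "(\<Sum>k\<le>m. f k i * g (m - k) (j - i))
        = F $ i * G $ (j - i) * (pochhammer (a + b + real j) m / fact m)" if "i \<le> j" for i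
    proof -
      have "a + b + real j = (a + real i) + (b + real (j - i))"
        using that by (simp add: of_nat_diff)
      then have "pochhammer (a + b + real j) m / fact m = (\<Sum>k\<le>m. pochhammer (a + real i) k / fact k
          * (pochhammer (b + real (j - i)) (m - k) / fact (m - k)))"
        by (simp only: pochhammer_Vandermonde[of "a + real i" "b + real (j - i)" m])
      then show ?thesis
        by (simp only: f_def g_def sum_distrib_left mult_ac)
    qed
    then show ?thesis
      by (subst sum.swap) (simp add: fps_mult_nth atLeast0AtMost sum_distrib_right del: times_divide_eq_right)
  qed
  ultimately show ?thesis
    by (simp add: fps_mult_nth atLeast0AtMost)
qed

text \<open>The formal expansion of \<open>(1 - c z)^(-a)\<close>.\<close>

definition neg_binomial_fps :: "'a :: field_char_0 \<Rightarrow> 'a \<Rightarrow> 'a fps" where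
  "neg_binomial_fps a c = Abs_fps (\<lambda>j. pochhammer a j / fact j * c ^ j)"

lemma neg_binomial_fps_nth [simp]:
  "neg_binomial_fps a c $ j = pochhammer a j / fact j * c ^ j"
  by (simp add: neg_binomial_fps_def)

lemma prod_fps_nonneg:
  fixes F :: "'i \<Rightarrow> real fps"
  assumes "\<And>i j. i \<in> I \<Longrightarrow> F i $ j \<ge> 0"
  shows "(\<Prod>i\<in>I. F i) $ j \<ge> 0"
  using assms
  by (induction I arbitrary: j rule: infinite_finite_induct)
    (auto simp: fps_mult_nth intro!: sum_nonneg mult_nonneg_nonneg)

text \<open>Induction over the factors, with \<open>m\<close> generalised: each multiplication draws
  on the moments of every order of the remaining product.\<close>

lemma neg_binomial_prod_moment_sums:
  fixes \<alpha> c :: "'i \<Rightarrow> real"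
  assumes "finite I" and "\<And>i. i \<in> I \<Longrightarrow> \<alpha> i \<ge> 0" and "\<And>i. i \<in> I \<Longrightarrow> 0 \<le> c i \<and> c i < 1"
  shows "(\<lambda>j. (\<Prod>i\<in>I. neg_binomial_fps (\<alpha> i) (c i)) $ j
        * (pochhammer ((\<Sum>i\<in>I. \<alpha> i) + real j) m / fact m))
      sums ((\<Prod>i\<in>I. Abs_fps (\<lambda>k. pochhammer (\<alpha> i) k / fact k * (1 - c i) powr (- \<alpha> i - real k))) $ m)"
  using assms
proof (induction I arbitrary: m rule: finite_induct)
  case empty
  \<comment> \<open>Only \<open>j = 0\<close> survives, and \<open>pochhammer 0 m\<close> vanishes
    unless \<open>m = 0\<close>.\<close>
  have "(\<lambda>j. (1 :: real fps) $ j * (pochhammer (real j) m / fact m))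
      = (\<lambda>j. if j = 0 then (1 :: real fps) $ m else 0)"
    by (auto simp: fps_one_nth pochhammer_0_left)
  then show ?case
    using sums_single[of 0 "\<lambda>_. (1 :: real fps) $ m"] by simp
next
  case (insert i I)
  have nonneg: "neg_binomial_fps (\<alpha> k) (c k) $ j \<ge> 0" if "k \<in> insert i I" for k j
    using insert.prems[OF that]
    by (auto simp: pochhammer_prod intro!: mult_nonneg_nonneg divide_nonneg_nonneg prod_nonneg)
  have "(\<lambda>j. (neg_binomial_fps (\<alpha> i) (c i) * (\<Prod>i\<in>I. neg_binomial_fps (\<alpha> i) (c i))) $ j
        * (pochhammer (\<alpha> i + (\<Sum>i\<in>I. \<alpha> i) + real j) m / fact m))
      sums ((Abs_fps (\<lambda>k. pochhammer (\<alpha> i) k / fact k * (1 - c i) powr (- \<alpha> i - real k)) *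
        (\<Prod>i\<in>I. Abs_fps (\<lambda>k. pochhammer (\<alpha> i) k / fact k * (1 - c i) powr (- \<alpha> i - real k)))) $ m)"
  proof (rule pochhammer_moment_sums_mult)
    show "(\<lambda>j. neg_binomial_fps (\<alpha> i) (c i) $ j * (pochhammer (\<alpha> i + real j) k / fact k)) sums
        (Abs_fps (\<lambda>k. pochhammer (\<alpha> i) k / fact k * (1 - c i) powr (- \<alpha> i - real k)) $ k)" for k
      using neg_binomial_moment_sums[of "c i" "\<alpha> i" k] insert.prems(2)[of i] by simp
    show "(\<lambda>j. (\<Prod>i\<in>I. neg_binomial_fps (\<alpha> i) (c i)) $ j
          * (pochhammer ((\<Sum>i\<in>I. \<alpha> i) + real j) k / fact k))
        sums ((\<Prod>i\<in>I. Abs_fps (\<lambda>k. pochhammer (\<alpha> i) k / fact k * (1 - c i) powr (- \<alpha> i - real k))) $ k)" for k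
      using insert by simp
  qed (use nonneg insert.prems in \<open>auto intro!: prod_fps_nonneg sum_nonneg simp del: neg_binomial_fps_nth\<close>)
  then show ?case
    using insert.hyps by (simp add: add.assoc)
qed

section \<open>Logarithmic derivatives and the recursion for the \<delta> coefficients\<close>

text \<open>Logarithmic derivatives of factors add up. Writing them as multipliers
  \<open>L i\<close> avoids dividing by \<open>F i\<close>.\<close>

lemma fps_deriv_prod_log:
  fixes F :: "'i \<Rightarrow> 'a :: comm_ring_1 fps"
  assumes "finite I" and "\<And>i. i \<in> I \<Longrightarrow> fps_deriv (F i) = L i * F i"
  shows "fps_deriv (\<Prod>i\<in>I. F i) = (\<Sum>i\<in>I. L i) * (\<Prod>i\<in>I. F i)"
  using assms by (induction I rule: finite_induct) (auto simp: algebra_simps)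

text \<open>The logarithmic derivative of \<open>(1 - c z)^(-a)\<close> is
  \<open>a c / (1 - c z)\<close>, a geometric series. Multiplying by \<open>1 - c z\<close> first
  reduces the claim to the ratio of consecutive coefficients.\<close>

lemma fps_deriv_neg_binomial:
  "fps_deriv (neg_binomial_fps a c) = Abs_fps (\<lambda>l. a * c ^ Suc l) * neg_binomial_fps a c"
proof -
  let ?P = "neg_binomial_fps a c"
  let ?g = "Abs_fps (\<lambda>l. c ^ l)"
  have g: "(1 - fps_const c * fps_X) * ?g = 1"
  proof (rule fps_ext)
    show "((1 - fps_const c * fps_X) * ?g) $ n = 1 $ n" for n
      by (cases n) (simp_all add: algebra_simps fps_X_mult_nth)
  qed
  have "(1 - fps_const c * fps_X) * fps_deriv ?P = fps_const (a * c) * ?P"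
  proof (rule fps_ext)
    fix j
    have "of_nat (Suc j) * ?P $ Suc j = pochhammer a (Suc j) / fact (Suc j) * of_nat (Suc j) * c ^ Suc j"
      by (simp only: neg_binomial_fps_nth mult_ac)
    also have "pochhammer a (Suc j) / fact (Suc j) * of_nat (Suc j) = (a + of_nat j) * (pochhammer a j / fact j)"
      by (simp add: pochhammer_Suc field_simps del: of_nat_Suc)
    finally have S: "of_nat (Suc j) * ?P $ Suc j = (a + of_nat j) * (c * ?P $ j)"
      by (simp add: mult_ac del: of_nat_Suc)
    have "((1 - fps_const c * fps_X) * fps_deriv ?P) $ j
        = of_nat (Suc j) * ?P $ Suc j - c * of_nat j * ?P $ j"
      by (cases j) (simp_all add: algebra_simps fps_X_mult_nth del: neg_binomial_fps_nth)
    with S show "((1 - fps_const c * fps_X) * fps_deriv ?P) $ j = (fps_const (a * c) * ?P) $ j"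
      by (simp add: algebra_simps del: neg_binomial_fps_nth)
  qed
  then have "?g * ((1 - fps_const c * fps_X) * fps_deriv ?P) = ?g * (fps_const (a * c) * ?P)"
    by simp
  then have "fps_deriv ?P = (fps_const (a * c) * ?g) * ?P"
    using g by (simp only: mult.assoc[symmetric] mult.commute[of ?g "1 - fps_const c * fps_X"]
        mult.commute[of ?g "fps_const (a * c)"] mult_1)
  moreover have "fps_const (a * c) * ?g = Abs_fps (\<lambda>l. a * c ^ Suc l)"
    by (simp add: fps_eq_iff mult_ac)
  ultimately show ?thesis by simp
qed

text \<open>The recursion for \<delta> is the comparison of coefficients in
  \<open>fps_deriv D = L * D\<close>, where \<open>L\<close> is the generating series of the numbers
  l \<gamma>(l), shifted down by one.\<close>

lemma delta_coeff_eq_fps_nth: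
  "delta_coeff n \<alpha> \<beta> j = (\<Prod>i=1..n. neg_binomial_fps (\<alpha> i) (1 - \<beta> 1 / \<beta> i)) $ j"
proof (induction j rule: less_induct)
  case (less j)
  define D where "D = (\<Prod>i=1..n. neg_binomial_fps (\<alpha> i) (1 - \<beta> 1 / \<beta> i))"
  define L where "L = (\<Sum>i=1..n. Abs_fps (\<lambda>l. \<alpha> i * (1 - \<beta> 1 / \<beta> i) ^ Suc l))"
  have L: "L $ l = real (Suc l) * gamma_coeff n \<alpha> \<beta> (Suc l)" for l
    by (simp add: L_def gamma_coeff_def fps_sum_nth sum_distrib_left del: of_nat_Suc power_Suc)
  have "fps_deriv D = L * D"
    unfolding D_def L_def by (rule fps_deriv_prod_log) (simp_all add: fps_deriv_neg_binomial)
  show ?case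
  proof (cases j)
    case 0
    have "D $ 0 = 1"
      unfolding D_def by (induction n) (simp_all add: prod.nat_ivl_Suc')
    with 0 show ?thesis by (simp add: D_def)
  next
    case (Suc k)
    have "real (Suc k) * D $ Suc k = fps_deriv D $ k"
      by simp
    also have "\<dots> = (\<Sum>l=0..k. L $ l * D $ (k - l))"
      by (simp only: \<open>fps_deriv D = L * D\<close> fps_mult_nth)
    also have "\<dots> = (\<Sum>l=0..k. real (Suc l) * gamma_coeff n \<alpha> \<beta> (Suc l) * delta_coeff n \<alpha> \<beta> (k - l))"
      using less Suc by (intro sum.cong) (simp_all add: L D_def)
    \<comment> \<open>\<open>Suc\<close> undoes the shift: coefficients of \<open>L\<close> are
      counted from 0, the \<gamma> from 1.\<close>
    also have "\<dots> = (\<Sum>l=1..k+1. real l * gamma_coeff n \<alpha> \<beta> l * delta_coeff n \<alpha> \<beta> (k + 1 - l))"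
      by (rule sum.reindex_bij_witness[of _ "\<lambda>l. l - 1" Suc]) auto
    finally have "D $ Suc k = delta_coeff n \<alpha> \<beta> (Suc k)"
      by (simp add: field_simps del: of_nat_Suc)
    with Suc show ?thesis by (simp add: D_def)
  qed
qed

section \<open>Coefficients of a product as sums over compositions\<close>

text \<open>\<open>fps_prod_nth'\<close> indexes the sum by multisets of size \<open>m\<close>; a
  multiset supported in \<open>I\<close> is determined by its multiplicities, which form a
  composition of \<open>m\<close>.\<close>

lemma fps_prod_nth_PiE:
  fixes F :: "'i \<Rightarrow> 'a :: comm_ring_1 fps"
  assumes "finite I"
  shows "(\<Prod>i\<in>I. F i) $ m = (\<Sum>h\<in>{h \<in> I \<rightarrow>\<^sub>E UNIV. (\<Sum>i\<in>I. h i) = m}. \<Prod>i\<in>I. F i $ h i)"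
proof -
  define M where "M h = (\<Sum>i\<in>I. replicate_mset (h i) i)" for h
  have count_M: "count (M h) i = (if i \<in> I then h i else 0)" for h i
    using assms by (simp add: M_def count_sum)
  have "(\<Prod>i\<in>I. F i) $ m = (\<Sum>X\<in>multisets_of_size I m. \<Prod>i\<in>I. F i $ count X i)"
    using assms by (rule fps_prod_nth')
  also have "\<dots> = (\<Sum>h\<in>{h \<in> I \<rightarrow>\<^sub>E UNIV. (\<Sum>i\<in>I. h i) = m}. \<Prod>i\<in>I. F i $ h i)"
  \<comment> \<open>\<open>count X\<close> is 0 outside \<open>I\<close>, whereas an extensional
    function is \<open>undefined\<close> there, hence \<open>restrict\<close>.\<close>
  proof (rule sum.reindex_bij_witness[of _ M "\<lambda>X. restrict (count X) I"])
    fix X assume X: "X \<in> multisets_of_size I m"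
    then have sub: "set_mset X \<subseteq> I" and size: "size X = m"
      by (auto simp: multisets_of_size_def)
    show "M (restrict (count X) I) = X"
      using sub by (auto simp: multiset_eq_iff count_M count_eq_zero_iff)
    have "(\<Sum>i\<in>I. count X i) = size X"
      unfolding size_multiset_overloaded_eq
      using assms sub by (intro sum.mono_neutral_right) (auto simp: count_eq_zero_iff)
    then show "restrict (count X) I \<in> {h \<in> I \<rightarrow>\<^sub>E UNIV. (\<Sum>i\<in>I. h i) = m}"
      using size by simp
    show "(\<Prod>i\<in>I. F i $ restrict (count X) I i) = (\<Prod>i\<in>I. F i $ count X i)"
      by simp
  next
    fix h assume h: "h \<in> {h \<in> I \<rightarrow>\<^sub>E UNIV. (\<Sum>i\<in>I. h i) = m}"
    then show "restrict (count (M h)) I = h"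
      by (auto simp: count_M PiE_iff extensional_def)
    have "set_mset (M h) \<subseteq> I"
      by (auto simp: count_M simp flip: count_greater_zero_iff split: if_splits)
    moreover have "size (M h) = m"
      using h by (simp add: M_def)
    ultimately show "M h \<in> multisets_of_size I m"
      by (simp add: multisets_of_size_def)
  qed
  finally show ?thesis .
qed

section \<open>From rising factorials to the stated identity\<close>

text \<open>Translates the factorial quotients on both sides of the identity; positivity keeps
  \<open>x\<close> away from the poles of Gamma.\<close>

lemma real_fact_ratio:
  assumes "x > 0"
  shows "real_fact (x + real m - 1) / real_fact (x - 1) = pochhammer x m"
proof -
  have "x \<notin> \<int>\<^sub>\<le>\<^sub>0"
    using assms by (auto elim!: nonpos_Ints_cases)
  then show ?thesis
    by (simp add: real_fact_def pochhammer_Gamma)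
qed

theorem theorem3p3:
  fixes n m :: nat and \<alpha> \<beta> :: "nat \<Rightarrow> real" and A :: real
  assumes "n \<ge> 1" and "m > 0"
    and "\<And>i. i \<in> {1..n} \<Longrightarrow> \<alpha> i > 0"
    and "\<And>i. i \<in> {1..n} \<Longrightarrow> \<beta> i > 0"
    and "\<beta> 1 = Min (\<beta> ` {1..n})"
    and "A = (\<Sum>i=1..n. \<alpha> i)"
  shows "summable (\<lambda>j. delta_coeff n \<alpha> \<beta> j *
           (real_fact (A + real j + real m - 1) / real_fact (A + real j - 1))) \<and>
         (\<Prod>i=1..n. (\<beta> 1 / \<beta> i) powr \<alpha> i) * \<beta> 1 ^ m *
           (\<Sum>j. delta_coeff n \<alpha> \<beta> j *
             (real_fact (A + real j + real m - 1) / real_fact (A + real j - 1)))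
         = (\<Sum>i\<in>weak_compositions n m. multinomial_coeff n m i *
             (\<Prod>k=1..n. real_fact (\<alpha> k + real (i k) - 1) / real_fact (\<alpha> k - 1) * \<beta> k ^ i k))"
proof -
  define D where "D = (\<Prod>i=1..n. neg_binomial_fps (\<alpha> i) (1 - \<beta> 1 / \<beta> i))"
  define P where "P = (\<Prod>i=1..n. (\<beta> 1 / \<beta> i) powr \<alpha> i)"
  \<comment> \<open>For \<open>c = 1 - \<beta> 1 / \<beta> i\<close> the base \<open>1 - c\<close>
    is \<open>\<beta> 1 / \<beta> i\<close>.\<close>
  define V where "V = (\<Prod>i=1..n. Abs_fps (\<lambda>k. pochhammer (\<alpha> i) k / fact k *
    (\<beta> 1 / \<beta> i) powr (- \<alpha> i - real k)))"
  have b1: "\<beta> 1 > 0"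
    using assms(1,4) by simp
  \<comment> \<open>Minimality of \<open>\<beta> 1\<close> is what puts every
    \<open>1 - \<beta> 1 / \<beta> i\<close> into [0, 1).\<close>
  have "\<beta> 1 \<le> \<beta> i" if "i \<in> {1..n}" for i
    using that assms(5) by simp
  then have "0 \<le> 1 - \<beta> 1 / \<beta> i \<and> 1 - \<beta> 1 / \<beta> i < 1" if "i \<in> {1..n}" for i
    using that assms(4)[OF that] b1 by simp
  then have "(\<lambda>j. D $ j * (pochhammer (A + real j) m / fact m)) sums (V $ m)"
    using neg_binomial_prod_moment_sums[of "{1..n}" \<alpha> "\<lambda>i. 1 - \<beta> 1 / \<beta> i" m] assms(3)
    by (simp add: D_def V_def assms(6) less_imp_le)
  \<comment> \<open>Undoes the division by \<open>fact m\<close>; the same factor later becomes the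
    numerator of the multinomial coefficient.\<close>
  then have "(\<lambda>j. fact m * (D $ j * (pochhammer (A + real j) m / fact m))) sums (fact m * V $ m)"
    by (rule sums_mult)
  moreover have "A > 0"
    unfolding assms(6) using assms(1,3) by (intro sum_pos) auto
  ultimately have sums: "(\<lambda>j. delta_coeff n \<alpha> \<beta> j *
      (real_fact (A + real j + real m - 1) / real_fact (A + real j - 1))) sums (fact m * V $ m)"
    by (simp add: real_fact_ratio delta_coeff_eq_fps_nth D_def add_pos_nonneg)
  have "P * \<beta> 1 ^ m * (fact m * V $ m)
      = (\<Sum>i\<in>weak_compositions n m. P * \<beta> 1 ^ m * (fact m *
          (\<Prod>k=1..n. pochhammer (\<alpha> k) (i k) / fact (i k) * (\<beta> 1 / \<beta> k) powr (- \<alpha> k - real (i k)))))"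
    by (simp add: V_def fps_prod_nth_PiE weak_compositions_def sum_distrib_left)
  also have "\<dots> = (\<Sum>i\<in>weak_compositions n m. multinomial_coeff n m i *
      (\<Prod>k=1..n. real_fact (\<alpha> k + real (i k) - 1) / real_fact (\<alpha> k - 1) * \<beta> k ^ i k))"
  proof (rule sum.cong[OF refl])
    fix i assume "i \<in> weak_compositions n m"
    \<comment> \<open>The parts of \<open>i\<close> sum to \<open>m\<close>, so all prefactors
      distribute over \<open>k\<close> and the identity can be checked factor by factor.\<close>
    then have "\<beta> 1 ^ m = (\<Prod>k=1..n. \<beta> 1 ^ i k)"
      by (auto simp: weak_compositions_def simp flip: power_sum)
    moreover have "(\<beta> 1 / \<beta> k) powr \<alpha> k * \<beta> 1 ^ i k *
          (pochhammer (\<alpha> k) (i k) / fact (i k) * (\<beta> 1 / \<beta> k) powr (- \<alpha> k - real (i k)))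
        = real_fact (\<alpha> k + real (i k) - 1) / real_fact (\<alpha> k - 1) * \<beta> k ^ i k / fact (i k)"
      if k: "k \<in> {1..n}" for k
    proof -
      have bk: "\<beta> k > 0" using assms(4)[OF k] .
      \<comment> \<open>The exponents \<open>\<alpha> k\<close> cancel; what remains turns
        \<open>\<beta> 1 ^ i k\<close> into \<open>\<beta> k ^ i k\<close>.\<close>
      have "(\<beta> 1 / \<beta> k) powr \<alpha> k * (\<beta> 1 / \<beta> k) powr (- \<alpha> k - real (i k))
          = (\<beta> 1 / \<beta> k) powr (- real (i k))"
        by (simp flip: powr_add)
      also have "\<dots> = \<beta> k ^ i k / \<beta> 1 ^ i k"
        using b1 bk by (simp add: powr_minus powr_realpow power_divide)
      finally have "(\<beta> 1 / \<beta> k) powr \<alpha> k * (\<beta> 1 / \<beta> k) powr (- \<alpha> k - real (i k)) * \<beta> 1 ^ i k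
          = \<beta> k ^ i k"
        using b1 by simp
      then show ?thesis
        using real_fact_ratio[OF assms(3)[OF k], of "i k"] by (simp add: mult_ac)
    qed
    ultimately have "P * \<beta> 1 ^ m * (\<Prod>k=1..n. pochhammer (\<alpha> k) (i k) / fact (i k) *
          (\<beta> 1 / \<beta> k) powr (- \<alpha> k - real (i k)))
        = (\<Prod>k=1..n. real_fact (\<alpha> k + real (i k) - 1) / real_fact (\<alpha> k - 1) * \<beta> k ^ i k / fact (i k))"
      by (simp only: P_def flip: prod.distrib) (rule prod.cong, simp_all)
    also have "\<dots> = (\<Prod>k=1..n. real_fact (\<alpha> k + real (i k) - 1) / real_fact (\<alpha> k - 1) * \<beta> k ^ i k)
        / (\<Prod>k=1..n. fact (i k))"
      by (rule prod_dividef)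
    finally show "P * \<beta> 1 ^ m * (fact m *
          (\<Prod>k=1..n. pochhammer (\<alpha> k) (i k) / fact (i k) * (\<beta> 1 / \<beta> k) powr (- \<alpha> k - real (i k))))
        = multinomial_coeff n m i *
          (\<Prod>k=1..n. real_fact (\<alpha> k + real (i k) - 1) / real_fact (\<alpha> k - 1) * \<beta> k ^ i k)"
      by (simp only: multinomial_coeff_def mult.left_commute[of _ "fact m"]
          times_divide_eq_left times_divide_eq_right)
  qed
  finally show ?thesis
    using sums by (simp add: P_def sums_iff)
qed

end
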